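(* For every instance of the strategic facility location game with all clients and facilities located on a line, with $n$ clients, $k$ of them strategic, where $k<n$, the strong price of anarchy and the strong price of stability of $GM^*$ are upper bounded by $\frac{n+k}{n-k}$.
   Context: Setting (line metric). The metric space is the real line $\mathbb{R}$ with $d(x,y)=|x-y|$. An instance consists of a set $\mathcal{C}$ of $n$ clients, each having a true location on the line (several clients may share a location; the true location of client $i$ is also denoted $i$); a finite nonempty set $\mathcal{F}\subset\mathbb{R}$ of possible facility locations, ordered from left to right (the leftmost is the lowest-numbered); and a partition $\mathcal{C}=T\cup L$, $T\cap L=\emptyset$, with $|L|=k\ge 1$, $|T|=n-k$. Clients in $T$ always report their true location; each client $i\in L$ (strategic) may report any point $x_i$ of the line. Let $\vec t$ be the vector of true locations of clients in $T$ and $\vec x=(x_i)_{i\in L}$ the vector of reports of the strategic clients. Perceived cost of $A\in\mathcal{F}$: $cost_A(\vec t;\vec x)=\sum_{i\in T}d(i,A)+\sum_{i\in L}d(x_i,A)$. Mechanism $GM^*$: given reports $(\vec t;\vec x)$, output the facility $GM^*(\vec t;\vec x)\in\mathcal{F}$ minimizing $cost_A(\vec t;\vec x)$ over $A\in\mathcal{F}$, ties broken in favor of the lowest-numbered facility. Strong Nash equilibrium (SNE) under a mechanism $M$: a profile $(\vec t;\vec x)$ such that for every nonempty set $I\subseteq L$ and every vector $x_I'$ of reports for the clients in $I$, there is a client $i\in I$ with $d(i,M(\vec t;\vec x_{-I},x_I'))\ge d(i,M(\vec t;\vec x))$, where $(\vec x_{-I},x_I')$ is $\vec x$ with the reports of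 clients in $I$ replaced by $x_I'$. Let $O\in\mathcal{F}$ minimize the true cost $\sum_{i\in\mathcal{C}}d(i,O)$, and let $S$ be the set of facilities $A$ such that some SNE under the mechanism selects $A$. The strong price of stability (resp. strong price of anarchy) of the instance is the infimum (resp. supremum) over $A\in S$ of $\frac{\sum_{i\in\mathcal{C}}d(i,A)}{\sum_{i\in\mathcal{C}}d(i,O)}$. Saying that the strong price of stability (resp. anarchy) is at most $c$ means that some (resp. every) $A\in S$ satisfies $\sum_{i\in\mathcal{C}}d(i,A)\le c\sum_{i\in\mathcal{C}}d(i,O)$ (this is also the meaning when the optimal cost is $0$). *)

theory Defs
  imports Complex_Main "HOL-Library.Extended_Nonnegative_Real"
begin

text \<open>An instance on the line consists of a set \<open>F\<close> of facility locations, a client set that is the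
  disjoint union of the truthful clients \<open>T\<close> and the strategic clients \<open>L\<close>, and the true locations
  \<open>loc\<close>.  Clients are abstract names, so several of them may share a location.  A report vector is a
  function \<open>x\<close> on all clients of which only the values on \<open>L\<close> matter.  Since the reports on \<open>T\<close> are
  fixed to the true locations, a mechanism is here a function of \<open>x\<close>.\<close>

definition total_cost :: "'c set \<Rightarrow> ('c \<Rightarrow> real) \<Rightarrow> real \<Rightarrow> real" where
  "total_cost C loc A = (\<Sum>i\<in>C. dist (loc i) A)"

definition opt_cost :: "real set \<Rightarrow> 'c set \<Rightarrow> ('c \<Rightarrow> real) \<Rightarrow> real" where
  "opt_cost F C loc = Min (total_cost C loc ` F)"

definition perceived_cost ::
    "'c set \<Rightarrow> 'c set \<Rightarrow> ('c \<Rightarrow> real) \<Rightarrow> ('c \<Rightarrow> real) \<Rightarrow> real \<Rightarrow> real" where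
  "perceived_cost T L loc x A = (\<Sum>i\<in>T. dist (loc i) A) + (\<Sum>i\<in>L. dist (x i) A)"

text \<open>Facilities are numbered from left to right, so the lowest-numbered minimizer is the least one.\<close>

definition GM_star ::
    "real set \<Rightarrow> 'c set \<Rightarrow> 'c set \<Rightarrow> ('c \<Rightarrow> real) \<Rightarrow> ('c \<Rightarrow> real) \<Rightarrow> real" where
  "GM_star F T L loc x =
     Min {A \<in> F. \<forall>B\<in>F. perceived_cost T L loc x A \<le> perceived_cost T L loc x B}"

definition strong_nash ::
    "'c set \<Rightarrow> ('c \<Rightarrow> real) \<Rightarrow> (('c \<Rightarrow> real) \<Rightarrow> real) \<Rightarrow> ('c \<Rightarrow> real) \<Rightarrow> bool" where
  "strong_nash L loc M x \<longleftrightarrow>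
     (\<forall>I y. I \<subseteq> L \<and> I \<noteq> {} \<longrightarrow>
        (\<exists>i\<in>I. dist (loc i) (M (override_on x y I)) \<ge> dist (loc i) (M x)))"

definition sne_facilities ::
    "'c set \<Rightarrow> ('c \<Rightarrow> real) \<Rightarrow> (('c \<Rightarrow> real) \<Rightarrow> real) \<Rightarrow> real set" where
  "sne_facilities L loc M = {M x | x. strong_nash L loc M x}"

text \<open>The prices are extended nonnegative reals, where \<open>0 / 0 = 0\<close>, \<open>a / 0 = \<infinity>\<close> for \<open>a > 0\<close>, the
  infimum of the empty set is \<open>\<infinity>\<close> and its supremum is \<open>0\<close>.  The two lemmas at the end spell out
  what upper bounds on the prices mean, also when the optimal cost is \<open>0\<close>.\<close>

definition strong_price_of_anarchy ::
    "real set \<Rightarrow> 'c set \<Rightarrow> 'c set \<Rightarrow> ('c \<Rightarrow> real) \<Rightarrow> (('c \<Rightarrow> real) \<Rightarrow> real) \<Rightarrow> ennreal" where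
  "strong_price_of_anarchy F T L loc M =
     (SUP A \<in> sne_facilities L loc M.
        ennreal (total_cost (T \<union> L) loc A) / ennreal (opt_cost F (T \<union> L) loc))"

definition strong_price_of_stability ::
    "real set \<Rightarrow> 'c set \<Rightarrow> 'c set \<Rightarrow> ('c \<Rightarrow> real) \<Rightarrow> (('c \<Rightarrow> real) \<Rightarrow> real) \<Rightarrow> ennreal" where
  "strong_price_of_stability F T L loc M =
     (INF A \<in> sne_facilities L loc M.
        ennreal (total_cost (T \<union> L) loc A) / ennreal (opt_cost F (T \<union> L) loc))"

lemma ennreal_ratio_le_iff:
  assumes "0 \<le> a" "0 \<le> b" "0 \<le> c"
  shows "ennreal a / ennreal b \<le> ennreal c \<longleftrightarrow> a \<le> c * b"
proof (cases "b = 0")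
  case True
  show ?thesis
  proof (cases "a = 0")
    case False
    with assms have "ennreal a / ennreal b = top"
      using True by (simp add: ennreal_divide_eq_top_iff)
    with False True assms show ?thesis by (simp add: top_unique)
  qed (use True assms in simp)
next
  case False
  with assms have "0 < b" by simp
  with assms show ?thesis by (simp add: divide_ennreal field_simps)
qed

lemma total_cost_nonneg: "0 \<le> total_cost C loc A"
  by (simp add: total_cost_def sum_nonneg)

lemma opt_cost_nonneg:
  assumes "finite F" "F \<noteq> {}"
  shows "0 \<le> opt_cost F C loc"
  using assms by (simp add: opt_cost_def total_cost_nonneg)

lemma GM_star_in:
  assumes "finite F" "F \<noteq> {}"
  shows "GM_star F T L loc x \<in> F"
proof -
  let ?S = "{A \<in> F. \<forall>B\<in>F. perceived_cost T L loc x A \<le> perceived_cost T L loc x B}"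
  have "arg_min_on (perceived_cost T L loc x) F \<in> ?S"
    using assms by (auto simp: arg_min_if_finite arg_min_least)
  then have "Min ?S \<in> ?S"
    using assms by (intro Min_in) auto
  then show ?thesis by (simp add: GM_star_def)
qed

lemma strong_price_of_anarchy_le_iff:
  assumes "finite F" "F \<noteq> {}" "0 \<le> c"
  shows "strong_price_of_anarchy F T L loc M \<le> ennreal c \<longleftrightarrow>
    (\<forall>A \<in> sne_facilities L loc M. total_cost (T \<union> L) loc A \<le> c * opt_cost F (T \<union> L) loc)"
  using assms
  by (simp add: strong_price_of_anarchy_def SUP_le_iff ennreal_ratio_le_iff
      total_cost_nonneg opt_cost_nonneg)

lemma strong_price_of_stability_le_iff:
  assumes "finite F" "F \<noteq> {}" "0 \<le> c" and M: "\<And>x. M x \<in> F"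
  shows "strong_price_of_stability F T L loc M \<le> ennreal c \<longleftrightarrow>
    (\<exists>A \<in> sne_facilities L loc M. total_cost (T \<union> L) loc A \<le> c * opt_cost F (T \<union> L) loc)"
    (is "_ \<longleftrightarrow> (\<exists>A \<in> ?S. _)")
proof -
  define f where
    "f A = ennreal (total_cost (T \<union> L) loc A) / ennreal (opt_cost F (T \<union> L) loc)" for A
  have f: "f A \<le> ennreal c \<longleftrightarrow> total_cost (T \<union> L) loc A \<le> c * opt_cost F (T \<union> L) loc" for A
    using assms by (simp add: f_def ennreal_ratio_le_iff total_cost_nonneg opt_cost_nonneg)
  have fin: "finite ?S"
    using M by (intro finite_subset[OF _ \<open>finite F\<close>]) (auto simp: sne_facilities_def)
  have "(INF A\<in>?S. f A) \<le> ennreal c \<longleftrightarrow> (\<exists>A\<in>?S. f A \<le> ennreal c)"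
  proof (cases "?S = {}")
    case True
    then show ?thesis by (simp add: top_unique)
  next
    case False
    with fin have "(INF A\<in>?S. f A) = Min (f ` ?S)"
      by (simp add: Min_Inf)
    with False fin show ?thesis by (simp add: Min_le_iff)
  qed
  then show ?thesis
    by (simp add: strong_price_of_stability_def f_def[symmetric] f)
qed

end

theory Submission
  imports Defs "HOL-Analysis.Line_Segment"
begin

text \<open>On the line the perceived cost is a convex function of the facility.

  An equilibrium exists: let every strategic client report a facility nearest to it. If a coalition
  prefers \<open>B\<close> to the outcome \<open>A\<close>, its members already report points beyond the neighbour \<open>P\<close> of
  \<open>A\<close> on the side of \<open>B\<close>, so no joint deviation can help \<open>P\<close> against \<open>A\<close>, and by convexity none can
  help \<open>B\<close>.

  For the bound, let \<open>A\<close> be the outcome of an equilibrium, \<open>Opt\<close> the optimum, \<open>D\<close> their distance,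
  and \<open>I\<close> the set of strategic clients that strictly prefer \<open>Opt\<close> to \<open>A\<close>. If all of \<open>I\<close> report \<open>Opt\<close>,
  the outcome lies between \<open>A\<close> and \<open>Opt\<close>; were it not \<open>A\<close>, all of \<open>I\<close> would gain. Hence it is \<open>A\<close>, and
  comparing perceived costs bounds the cost of \<open>A\<close> by the optimal cost plus \<open>m D\<close>, where \<open>m\<close> is the
  number of strategic clients outside \<open>I\<close>; with the
  triangle inequality the same comparison shows that \<open>(n - m) D\<close> is at most twice
  the optimal cost.\<close>

section \<open>Minimality, tie-breaking and convexity of perceived costs\<close>

lemma GM_star_minimizer:
  assumes "finite F" "F \<noteq> {}"
  shows "GM_star F T L loc x
    \<in> {A \<in> F. \<forall>B\<in>F. perceived_cost T L loc x A \<le> perceived_cost T L loc x B}" (is "_ \<in> ?S")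
proof -
  have "arg_min_on (perceived_cost T L loc x) F \<in> ?S"
    using assms by (auto simp: arg_min_if_finite arg_min_least)
  then show ?thesis
    unfolding GM_star_def using assms by (intro Min_in) auto
qed

lemma GM_star_le:
  assumes "finite F" "B \<in> F"
  shows "perceived_cost T L loc x (GM_star F T L loc x) \<le> perceived_cost T L loc x B"
  using GM_star_minimizer[of F T L loc x] assms by blast

text \<open>A tie with a facility further left would have been broken in its favour. This
  strictness, available on one side only, is what separates the left and right cases below.\<close>

lemma GM_star_less:
  assumes "finite F" "B \<in> F" "B < GM_star F T L loc x"
  shows "perceived_cost T L loc x (GM_star F T L loc x) < perceived_cost T L loc x B"
proof (rule ccontr)
  assume "\<not> ?thesis"
  then have "B \<in> {A \<in> F. \<forall>B\<in>F. perceived_cost T L loc x A \<le> perceived_cost T L loc x B}"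
    using assms(2) GM_star_le[OF assms(1), of _ T L loc x] by force
  then have "GM_star F T L loc x \<le> B"
    unfolding GM_star_def using assms(1) by (intro Min_le) auto
  then show False using assms(3) by simp
qed

lemma convex_on_perceived_cost: "convex_on UNIV (perceived_cost T L loc x)"
proof -
  have *: "convex_on UNIV (\<lambda>z. \<Sum>i\<in>A. dist (h i) z)" for A :: "'a set" and h :: "'a \<Rightarrow> real"
    by (induction A rule: infinite_finite_induct)
      (auto intro!: convex_on_add convex_on_dist simp: convex_on_const)
  show ?thesis
    unfolding perceived_cost_def by (intro convex_on_add *)
qed

text \<open>Cancelling the share of \<open>f u\<close> in the convexity inequality at
  \<open>w\<close> leaves \<open>f w\<close> against \<open>f v\<close>. Tie-breaking calls for both
  the weak and the strict form.\<close>

lemma convex_on_le_beyond: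
  fixes f :: "real \<Rightarrow> real"
  assumes f: "convex_on UNIV f" and w: "w \<in> open_segment u v"
  shows "f u \<le> f w \<Longrightarrow> f w \<le> f v" and "f u < f w \<Longrightarrow> f w < f v"
proof -
  obtain t where t: "0 < t" "t < 1" and w_eq: "w = (1 - t) * u + t * v"
    using w by (auto simp: in_segment)
  have le: "f w \<le> (1 - t) * f u + t * f v"
    using convex_onD[OF f, of t u v] t by (simp add: w_eq)
  show "f w \<le> f v" if "f u \<le> f w"
  proof -
    have "(1 - t) * f u \<le> (1 - t) * f w" using that t by simp
    with le have "t * f w \<le> t * f v" by (simp add: algebra_simps)
    with t show ?thesis by simp
  qed
  show "f w < f v" if "f u < f w"
  proof -
    have "(1 - t) * f u < (1 - t) * f w" using that t by simp
    with le have "t * f w < t * f v" by (simp add: algebra_simps)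
    with t show ?thesis by simp
  qed
qed

text \<open>The terms of \<open>T\<close> cancel, so the effect of changed reports is compared
  client by client.\<close>

lemma perceived_cost_diff_mono:
  assumes "\<And>i. i \<in> L \<Longrightarrow> dist (x i) z - dist (x i) w \<le> dist (y i) z - dist (y i) w"
  shows "perceived_cost T L loc x z - perceived_cost T L loc x w
    \<le> perceived_cost T L loc y z - perceived_cost T L loc y w"
proof -
  have "(\<Sum>i\<in>L. dist (x i) z - dist (x i) w) \<le> (\<Sum>i\<in>L. dist (y i) z - dist (y i) w)"
    by (intro sum_mono assms)
  then show ?thesis by (simp add: perceived_cost_def sum_subtractf)
qed

section \<open>Existence of a strong Nash equilibrium\<close>

text \<open>Because reports are facilities, a report strictly on one side of the outcome lies at or
  beyond the neighbouring facility on that side; a true location might fall short of it.\<close>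

lemma strong_nash_nearest_reports:
  assumes F: "finite F" "F \<noteq> {}"
    and x: "\<And>i. i \<in> L \<Longrightarrow> x i \<in> F" "\<And>i B. i \<in> L \<Longrightarrow> B \<in> F \<Longrightarrow> dist (loc i) (x i) \<le> dist (loc i) B"
  shows "strong_nash L loc (GM_star F T L loc) x"
proof (rule ccontr)
  let ?GM = "GM_star F T L loc"
  assume "\<not> ?thesis"
  then obtain I y where I: "I \<subseteq> L" "I \<noteq> {}"
    and gain: "\<And>i. i \<in> I \<Longrightarrow> dist (loc i) (?GM (override_on x y I)) < dist (loc i) (?GM x)"
    unfolding strong_nash_def not_le[symmetric] by blast
  define A where "A = ?GM x"
  define x' where "x' = override_on x y I"
  define B where "B = ?GM x'"
  have AB: "A \<in> F" "B \<in> F" using F by (simp_all add: A_def B_def GM_star_in)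
  have gain: "dist (loc i) B < dist (loc i) A" if "i \<in> I" for i
    using gain[OF that] by (simp add: A_def B_def x'_def)
  have nearer: "dist (loc i) (x i) < dist (loc i) A" if "i \<in> I" for i
    using gain[OF that] x(2)[of i B] that I AB by force
  have "A \<noteq> B" using gain I by fastforce
  \<comment> \<open>A member whose report has \<open>P\<close> between it and \<open>A\<close>
    already favours \<open>P\<close> by the full \<open>dist P A\<close>, the most that any report
    can do.\<close>
  have diff: "perceived_cost T L loc x P - perceived_cost T L loc x A
      \<le> perceived_cost T L loc x' P - perceived_cost T L loc x' A"
    if "\<And>i. i \<in> I \<Longrightarrow> P \<in> closed_segment A (x i)" for P
  proof (rule perceived_cost_diff_mono)
    fix i assume "i \<in> L"
    show "dist (x i) P - dist (x i) A \<le> dist (x' i) P - dist (x' i) A"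
    proof (cases "i \<in> I")
      case True
      have "dist (x i) A = dist (x i) P + dist P A"
        using that[OF True] by (auto simp: closed_segment_eq_real_ivl dist_real_def split: if_splits)
      then show ?thesis using dist_triangle[of "x' i" A P] by simp
    qed (simp add: x'_def)
  qed
  consider "B < A" | "A < B" using \<open>A \<noteq> B\<close> by linarith
  then show False
  proof cases
    case 1
    define P where "P = Max {Z \<in> F. Z < A}"
    have "P \<in> {Z \<in> F. Z < A}"
      unfolding P_def using F AB 1 by (intro Max_in) auto
    then have P: "P \<in> F" "P < A" by auto
    have le_P: "Z \<le> P" if "Z \<in> F" "Z < A" for Z
      unfolding P_def using F that by (intro Max_ge) auto
    have "P \<in> closed_segment A (x i)" if "i \<in> I" for i
    proof -
      \<comment> \<open>Preferring \<open>B\<close> puts \<open>loc i\<close> left of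
        \<open>A\<close>; a report nearer to it than \<open>A\<close> is then also left of
        \<open>A\<close>.\<close>
      have "x i < A"
        using gain[OF that] nearer[OF that] 1 by (auto simp: dist_real_def)
      then have "x i \<le> P" using le_P x(1) that I by blast
      with P show ?thesis by (simp add: closed_segment_eq_real_ivl)
    qed
    from diff[OF this] GM_star_less[OF F(1) P(1), of T L loc x] P(2)
    have less: "perceived_cost T L loc x' A < perceived_cost T L loc x' P"
      by (simp add: A_def)
    have "perceived_cost T L loc x' P \<le> perceived_cost T L loc x' B"
    proof (cases "P = B")
      case False
      then have "P \<in> open_segment A B"
        using le_P[OF AB(2) 1] P by (simp add: open_segment_eq_real_ivl)
      then show ?thesis
        by (rule convex_on_le_beyond(1)[OF convex_on_perceived_cost]) (use less in simp)
    qed simp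
    with less GM_star_le[OF F(1) AB(1), of T L loc x'] show False
      by (simp add: B_def)
  next
    case 2
    define P where "P = Min {Z \<in> F. A < Z}"
    have "P \<in> {Z \<in> F. A < Z}"
      unfolding P_def using F AB 2 by (intro Min_in) auto
    then have P: "P \<in> F" "A < P" by auto
    have P_le: "P \<le> Z" if "Z \<in> F" "A < Z" for Z
      unfolding P_def using F that by (intro Min_le) auto
    have "P \<in> closed_segment A (x i)" if "i \<in> I" for i
    proof -
      have "A < x i"
        using gain[OF that] nearer[OF that] 2 by (auto simp: dist_real_def)
      then have "P \<le> x i" using P_le x(1) that I by blast
      with P show ?thesis by (simp add: closed_segment_eq_real_ivl)
    qed
    \<comment> \<open>Here \<open>A\<close> beats \<open>P\<close> only weakly; the contradiction
      comes from tie-breaking against \<open>B\<close>, which lies right of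
      \<open>A\<close>.\<close>
    from diff[OF this] GM_star_le[OF F(1) P(1), of T L loc x]
    have le: "perceived_cost T L loc x' A \<le> perceived_cost T L loc x' P"
      by (simp add: A_def)
    have "perceived_cost T L loc x' P \<le> perceived_cost T L loc x' B"
    proof (cases "P = B")
      case False
      then have "P \<in> open_segment A B"
        using P_le[OF AB(2) 2] P by (simp add: open_segment_eq_real_ivl)
      then show ?thesis
        by (rule convex_on_le_beyond(1)[OF convex_on_perceived_cost]) (rule le)
    qed simp
    with le GM_star_less[OF F(1) AB(1), of T L loc x'] 2 show False
      by (simp add: B_def)
  qed
qed

text \<open>Needed for the stability bound: an infimum over no equilibria would be infinite.\<close>

corollary sne_facilities_GM_star_nonempty:
  assumes F: "finite F" "F \<noteq> {}"
  shows "sne_facilities L loc (GM_star F T L loc) \<noteq> {}"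
proof -
  define x where "x i = arg_min_on (dist (loc i)) F" for i
  have "strong_nash L loc (GM_star F T L loc) x"
    using F by (intro strong_nash_nearest_reports)
      (auto simp: x_def arg_min_if_finite arg_min_least)
  then show ?thesis by (auto simp: sne_facilities_def)
qed

section \<open>Joint reports at the optimum\<close>

text \<open>Moving reports to \<open>Opt\<close> can only raise the cost of a facility relative to
  those between it and \<open>Opt\<close>. An outcome beyond \<open>A\<close> thus loses to
  \<open>A\<close>, and one beyond \<open>Opt\<close> loses to \<open>Opt\<close>, which by
  convexity already did no worse under \<open>x\<close>.\<close>

lemma GM_star_deviation_between:
  assumes F: "finite F" and opt: "Opt \<in> F"
  shows "GM_star F T L loc (override_on x (\<lambda>_. Opt) I) \<in> closed_segment (GM_star F T L loc x) Opt"
proof (rule ccontr)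
  define A where "A = GM_star F T L loc x"
  define y where "y = override_on x (\<lambda>_. Opt) I"
  define B where "B = GM_star F T L loc y"
  let ?f = "perceived_cost T L loc x" and ?g = "perceived_cost T L loc y"
  assume "\<not> ?thesis"
  then have notin: "B \<notin> closed_segment A Opt" by (simp add: A_def B_def y_def)
  have "F \<noteq> {}" using opt by auto
  with F have AB: "A \<in> F" "B \<in> F" by (simp_all add: A_def B_def GM_star_in)
  note A = GM_star_le[OF F, of _ T L loc x, folded A_def] GM_star_less[OF F, of _ T L loc x, folded A_def]
  note B = GM_star_le[OF F, of _ T L loc y, folded B_def] GM_star_less[OF F, of _ T L loc y, folded B_def]
  have diff: "?f z - ?f w \<le> ?g z - ?g w" if "w \<in> closed_segment Opt z" for z w
  proof (rule perceived_cost_diff_mono)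
    fix i
    show "dist (x i) z - dist (x i) w \<le> dist (y i) z - dist (y i) w"
    proof (cases "i \<in> I")
      case True
      have "dist Opt z = dist Opt w + dist w z"
        using that by (auto simp: closed_segment_eq_real_ivl dist_real_def split: if_splits)
      then show ?thesis using True dist_triangle[of "x i" z w] by (simp add: y_def)
    qed (simp add: y_def)
  qed
  have beyond_A: "?f B - ?f A \<le> ?g B - ?g A" if "A \<in> closed_segment Opt B"
    using diff[OF that] .
  have beyond_O: "?f B - ?f Opt \<le> ?g B - ?g Opt"
    by (rule diff) simp
  \<comment> \<open>When \<open>B\<close> is left of the facility it is compared with, strictness
    comes from the choice under \<open>x\<close>; when right of it, from the choice under
    \<open>y\<close>.\<close>
  consider "B < A" "A \<le> Opt" | "A \<le> Opt" "Opt < B" | "Opt \<le> A" "A < B" | "B < Opt" "Opt \<le> A"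
    using notin by (auto simp: closed_segment_eq_real_ivl split: if_splits)
  then show False
  proof cases
    case 1
    then have "A \<in> closed_segment Opt B" by (simp add: closed_segment_eq_real_ivl)
    with beyond_A A(2)[OF AB(2)] B(1)[OF AB(1)] 1 show False by simp
  next
    case 2
    have "?f Opt \<le> ?f B"
    proof (cases "A = Opt")
      case False
      with 2 have "Opt \<in> open_segment A B" by (simp add: open_segment_eq_real_ivl)
      then show ?thesis
        using convex_on_le_beyond(1)[OF convex_on_perceived_cost] A(1)[OF opt] by blast
    qed (use A(1)[OF AB(2)] in simp)
    with beyond_O B(2)[OF opt] 2 show False by simp
  next
    case 3
    then have "A \<in> closed_segment Opt B" by (simp add: closed_segment_eq_real_ivl)
    with beyond_A A(1)[OF AB(2)] B(2)[OF AB(1)] 3 show False by simp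
  next
    case 4
    have "?f Opt < ?f B"
    proof (cases "A = Opt")
      case False
      with 4 have "Opt \<in> open_segment A B" by (simp add: open_segment_eq_real_ivl)
      then show ?thesis
        using convex_on_le_beyond(2)[OF convex_on_perceived_cost] A(2)[OF opt] 4 False by force
    qed (use A(2)[OF AB(2)] 4 in simp)
    with beyond_O B(1)[OF opt] show False by simp
  qed
qed

text \<open>The points nearer to \<open>p\<close> than \<open>u\<close> form an open interval with
  \<open>u\<close> as an endpoint; it contains \<open>v\<close>, hence the segment except
  \<open>u\<close>.\<close>

lemma closer_of_between:
  fixes p :: real
  assumes "z \<in> closed_segment u v" "z \<noteq> u" "dist p v < dist p u"
  shows "dist p z < dist p u"
  using assms by (auto simp: closed_segment_eq_real_ivl dist_real_def abs_if split: if_splits)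

lemma strong_nash_joint_report:
  assumes F: "finite F" and opt: "Opt \<in> F"
    and x: "strong_nash L loc (GM_star F T L loc) x"
    and A: "A = GM_star F T L loc x"
    and I: "I = {i \<in> L. dist (loc i) Opt < dist (loc i) A}"
  shows "GM_star F T L loc (override_on x (\<lambda>_. Opt) I) = A" (is "?B = A")
proof (rule ccontr)
  assume "?B \<noteq> A"
  \<comment> \<open>With \<open>I\<close> empty the reports, and so the outcome, would be
    unchanged.\<close>
  then have "I \<noteq> {}" by (auto simp: A override_on_emptyset)
  moreover have "I \<subseteq> L" by (auto simp: I)
  ultimately obtain i where i: "i \<in> I" "dist (loc i) A \<le> dist (loc i) ?B"
    using x unfolding strong_nash_def A by blast
  have "?B \<in> closed_segment A Opt"
    unfolding A by (rule GM_star_deviation_between[OF F opt])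
  moreover have "dist (loc i) Opt < dist (loc i) A" using i(1) by (simp add: I)
  ultimately have "dist (loc i) ?B < dist (loc i) A"
    using \<open>?B \<noteq> A\<close> closer_of_between by blast
  with i(2) show False by simp
qed

section \<open>Counting argument for the cost of an equilibrium outcome\<close>

lemma total_cost_le_of_joint_report:
  assumes fin: "finite T" "finite L" and disj: "T \<inter> L = {}"
    and I: "I = {i \<in> L. dist (loc i) Opt < dist (loc i) A}"
    and le: "perceived_cost T L loc (override_on x (\<lambda>_. Opt) I) A
      \<le> perceived_cost T L loc (override_on x (\<lambda>_. Opt) I) Opt"
  shows "real (card T) * total_cost (T \<union> L) loc A
    \<le> (real (card T) + 2 * real (card L)) * total_cost (T \<union> L) loc Opt"
proof -
  define D where "D = dist A Opt"
  define J where "J = L - I"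
  have L: "L = I \<union> J" "I \<inter> J = {}" and fin': "finite I" "finite J"
    using fin by (auto simp: I J_def)
  define t where "t z = (\<Sum>i\<in>T. dist (loc i) z)" for z
  define a where "a z = (\<Sum>i\<in>I. dist (loc i) z)" for z
  define b where "b z = (\<Sum>i\<in>J. dist (loc i) z)" for z
  define r where "r z = (\<Sum>i\<in>J. dist (x i) z)" for z
  have total: "total_cost (T \<union> L) loc z = t z + a z + b z" for z
    using disj fin fin' L by (simp add: total_cost_def sum.union_disjoint t_def a_def b_def)
  have "(\<Sum>i\<in>I. dist (override_on x (\<lambda>_. Opt) I i) z) = real (card I) * dist Opt z" for z
    by simp
  moreover have "(\<Sum>i\<in>J. dist (override_on x (\<lambda>_. Opt) I i) z) = r z" for z
    unfolding r_def by (intro sum.cong) (auto simp: J_def)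
  ultimately have perceived: "perceived_cost T L loc (override_on x (\<lambda>_. Opt) I) z
      = t z + (real (card I) * dist Opt z + r z)" for z
    using fin' L by (simp add: perceived_cost_def sum.union_disjoint t_def)
  have "r Opt \<le> (\<Sum>i\<in>J. dist (x i) A + D)"
    unfolding r_def D_def by (intro sum_mono dist_triangle)
  then have "r Opt \<le> r A + real (card J) * D" by (simp add: r_def sum.distrib)
  \<comment> \<open>Each member of \<open>I\<close> reports \<open>Opt\<close> and charges
    \<open>A\<close> an extra \<open>D\<close>; each client of \<open>J\<close>, whatever it
    reports, favours \<open>A\<close> by at most \<open>D\<close>.\<close>
  with le have t_le: "t A \<le> t Opt + (real (card J) - real (card I)) * D"
    by (simp add: perceived D_def dist_commute algebra_simps)
  have "a A \<le> (\<Sum>i\<in>I. dist (loc i) Opt + D)"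
    unfolding a_def D_def by (intro sum_mono) (metis dist_commute dist_triangle)
  then have a_le: "a A \<le> a Opt + real (card I) * D" by (simp add: a_def sum.distrib)
  have b_le: "b A \<le> b Opt"
    unfolding b_def by (intro sum_mono) (auto simp: I J_def)
  have "(\<Sum>i\<in>T. D) \<le> (\<Sum>i\<in>T. dist (loc i) A + dist (loc i) Opt)"
    unfolding D_def by (intro sum_mono) (metis dist_commute dist_triangle)
  then have "real (card T) * D \<le> t A + t Opt" by (simp add: t_def sum.distrib)
  moreover have "(\<Sum>i\<in>J. D) \<le> (\<Sum>i\<in>J. 2 * dist (loc i) Opt)"
  proof (intro sum_mono)
    fix i assume "i \<in> J"
    then have "dist (loc i) A \<le> dist (loc i) Opt" by (auto simp: I J_def)
    then show "D \<le> 2 * dist (loc i) Opt"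
      using dist_triangle[of A Opt "loc i"] by (simp add: D_def dist_commute)
  qed
  then have "real (card J) * D \<le> 2 * b Opt" by (simp add: b_def sum_distrib_left)
  \<comment> \<open>Bounding \<open>t A\<close> by \<open>t_le\<close> adds
    \<open>(card J - card I) * D\<close> on the right; the \<open>card J\<close> part
    cancels.\<close>
  ultimately have "(real (card T) + real (card I)) * D \<le> 2 * t Opt + 2 * b Opt"
    using t_le by (simp add: algebra_simps)
  moreover have "0 \<le> a Opt" and "0 \<le> D" by (simp_all add: a_def D_def sum_nonneg)
  ultimately have D_le: "real (card T) * D \<le> 2 * total_cost (T \<union> L) loc Opt"
    by (simp add: total algebra_simps) (smt (verit) mult_nonneg_nonneg of_nat_0_le_iff)
  have "card J \<le> card L" using fin by (simp add: J_def card_mono)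
  then have "real (card J) * D \<le> real (card L) * D"
    using \<open>0 \<le> D\<close> by (intro mult_right_mono) auto
  \<comment> \<open>The extra \<open>card I * D\<close> in \<open>a_le\<close> cancels against the
    same amount subtracted in \<open>t_le\<close>.\<close>
  with t_le a_le b_le have "total_cost (T \<union> L) loc A
      \<le> total_cost (T \<union> L) loc Opt + real (card L) * D"
    by (simp add: total algebra_simps)
  then have "real (card T) * total_cost (T \<union> L) loc A
      \<le> real (card T) * (total_cost (T \<union> L) loc Opt + real (card L) * D)"
    by (intro mult_left_mono) auto
  also have "\<dots> \<le> (real (card T) + 2 * real (card L)) * total_cost (T \<union> L) loc Opt"
    using mult_left_mono[OF D_le, of "real (card L)"] by (simp add: algebra_simps)
  finally show ?thesis .
qed

theorem theorem4p5:
  fixes C T L :: "'c set" and F :: "real set" and loc :: "'c \<Rightarrow> real" and n k :: nat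
  assumes "finite C" and "C = T \<union> L" and "T \<inter> L = {}"
    and "card C = n" and "card L = k" and "1 \<le> k" and "k < n"
    and "finite F" and "F \<noteq> {}"
  shows "strong_price_of_anarchy F T L loc (GM_star F T L loc)
           \<le> ennreal ((real n + real k) / (real n - real k))
       \<and> strong_price_of_stability F T L loc (GM_star F T L loc)
           \<le> ennreal ((real n + real k) / (real n - real k))"
proof -
  let ?c = "(real n + real k) / (real n - real k)"
  let ?S = "sne_facilities L loc (GM_star F T L loc)"
  have fin: "finite T" "finite L" using assms(1,2) by auto
  then have card_T: "card T + k = n"
    using assms(2-5) by (simp add: card_Un_disjoint)
  have c: "0 \<le> ?c" using \<open>k < n\<close> by simp
  have "opt_cost F (T \<union> L) loc \<in> total_cost (T \<union> L) loc ` F"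
    unfolding opt_cost_def using assms(8,9) by (intro Min_in) auto
  then obtain Opt where opt: "Opt \<in> F" "opt_cost F (T \<union> L) loc = total_cost (T \<union> L) loc Opt"
    by auto
  have bound: "total_cost (T \<union> L) loc A \<le> ?c * opt_cost F (T \<union> L) loc" if A_sne: "A \<in> ?S" for A
  proof -
    obtain x where x: "strong_nash L loc (GM_star F T L loc) x" and A: "A = GM_star F T L loc x"
      using A_sne unfolding sne_facilities_def by blast
    define I where "I = {i \<in> L. dist (loc i) Opt < dist (loc i) A}"
    have "perceived_cost T L loc (override_on x (\<lambda>_. Opt) I) A
        \<le> perceived_cost T L loc (override_on x (\<lambda>_. Opt) I) Opt"
      using GM_star_le[OF assms(8) opt(1), of T L loc "override_on x (\<lambda>_. Opt) I"]
        strong_nash_joint_report[OF assms(8) opt(1) x A I_def] by simp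
    from total_cost_le_of_joint_report[OF fin assms(3) I_def this] assms(5)
    have "real (card T) * total_cost (T \<union> L) loc A
        \<le> (real (card T) + 2 * real k) * total_cost (T \<union> L) loc Opt" by simp
    \<comment> \<open>This turns the factor \<open>card T + 2 * k\<close> into
      \<open>n + k\<close>.\<close>
    moreover have "real (card T) = real n - real k" using card_T by linarith
    ultimately show ?thesis
      using \<open>k < n\<close> by (simp add: opt(2) field_simps)
  qed
  have "strong_price_of_anarchy F T L loc (GM_star F T L loc) \<le> ennreal ?c"
    using bound assms(8,9) c by (simp add: strong_price_of_anarchy_le_iff)
  moreover have "strong_price_of_stability F T L loc (GM_star F T L loc) \<le> ennreal ?c"
  proof -
    obtain A where "A \<in> ?S"
      using sne_facilities_GM_star_nonempty[OF assms(8,9)] by blast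
    with bound show ?thesis
      using strong_price_of_stability_le_iff
        [OF assms(8,9) c, of "GM_star F T L loc" T L loc, OF GM_star_in[OF assms(8,9)]] by blast
  qed
  ultimately show ?thesis by blast
qed

end
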